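(* Let $s$ be the unique real solution of the initial value problem $\ddot{s}(t) = 6t - 6 s(t)^2$, $s(0) = \dot{s}(0) = 0$. Let $0 < a < b$. If $s(t) > \sqrt{t}$ for all $t$ in the interval $(a, b)$, and if $s(a) = \sqrt{a}$ and $s(b) = \sqrt{b}$, then $$b - a > \pi \, \bigl(6(1 + \sqrt{3})\bigr)^{-1/2} \, b^{-1/4}.$$
   Context: Dots denote derivatives with respect to the real variable $t$. The solution $s$ is taken on its maximal real interval of existence, which contains $[0, \infty)$; it is considered only for nonnegative arguments. *)

theory Defs
  imports Complex_Main
begin

text \<open>
  The maximal solution exists on an interval containing \<open>[0, \<infinity>)\<close> and is only evaluated at
  nonnegative arguments, so the equation is required on \<open>[0, \<infinity>)\<close> only, with one-sided
  derivatives at \<open>0\<close>. There \<open>v\<close> is the first derivative of \<open>s\<close>.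
\<close>

definition solves_ivp :: "(real \<Rightarrow> real) \<Rightarrow> bool" where
  "solves_ivp s \<longleftrightarrow>
     (\<exists>v. (\<forall>t\<ge>0. (s has_real_derivative v t) (at t within {0..}) \<and>
                  (v has_real_derivative 6 * t - 6 * (s t)\<^sup>2) (at t within {0..})) \<and>
          s 0 = 0 \<and> v 0 = 0)"

end

theory Submission
  imports Defs "HOL-Analysis.Analysis"
begin

text \<open>
  The energy \<open>E = v\<^sup>2 / 2 + 2 s\<^sup>3 - 6 t s\<close> vanishes at \<open>0\<close> and has derivative \<open>-6 s\<close>. As long as
  \<open>s > 0\<close> it is therefore negative, whereas \<open>E \<ge> 0\<close> at a zero of \<open>s\<close>; hence \<open>s\<close> stays positive
  for all \<open>t > 0\<close>, and \<open>E < 0\<close> then gives \<open>s\<^sup>2 < 3 t\<close>. The difference \<open>x = s - sqrt t\<close> satisfies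
  \<open>x'' = - 6 (s + sqrt t) x + t\<^sup>-\<^sup>3\<^sup>/\<^sup>2 / 4\<close>, and \<open>6 (s + sqrt t) < \<omega>\<^sup>2 = 6 (1 + sqrt 3) sqrt b\<close> on
  \<open>(a, b)\<close>, so Sturm comparison with \<open>sin (\<omega> (t - a))\<close> gives \<open>b - a > \<pi> / \<omega>\<close>.
\<close>

text \<open>The Wronskian-type \<open>W\<close> of \<open>x\<close> and
  \<open>sin (\<omega> * (t - a))\<close> has derivative
  \<open>(x'' t + \<omega>\<^sup>2 * x t) * sin (\<omega> * (t - a))\<close>. If
  \<open>b - a\<close> were at most \<open>pi / \<omega>\<close>, the sine would be positive inside
  the interval, so \<open>W\<close> would increase strictly from \<open>W a = 0\<close>; but
  \<open>W b = x' b * sin (\<omega> * (b - a))\<close> is nonpositive.\<close>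

lemma sturm_comparison_sin:
  fixes x x' x'' :: "real \<Rightarrow> real" and a b \<omega> :: real
  assumes "a < b" "0 < \<omega>"
    and x: "\<And>t. t \<in> {a..b} \<Longrightarrow> (x has_real_derivative x' t) (at t)"
    and x': "\<And>t. t \<in> {a..b} \<Longrightarrow> (x' has_real_derivative x'' t) (at t)"
    and "x a = 0" "x b = 0"
    and pos: "\<And>t. t \<in> {a<..<b} \<Longrightarrow> 0 < x t"
    and ineq: "\<And>t. t \<in> {a<..<b} \<Longrightarrow> 0 < x'' t + \<omega>\<^sup>2 * x t"
  shows "pi / \<omega> < b - a"
proof (rule ccontr)
  assume "\<not> pi / \<omega> < b - a"
  then have le: "\<omega> * (b - a) \<le> pi"
    using \<open>0 < \<omega>\<close> by (simp add: field_simps)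
  define W where "W t = x' t * sin (\<omega> * (t - a)) - x t * (\<omega> * cos (\<omega> * (t - a)))" for t
  have W: "(W has_real_derivative (x'' t + \<omega>\<^sup>2 * x t) * sin (\<omega> * (t - a))) (at t)"
    if "t \<in> {a..b}" for t
    unfolding W_def
    by (rule derivative_eq_intros x[OF that] x'[OF that] refl)+
      (simp add: algebra_simps power2_eq_square)
  have "W a < W b"
  proof (rule DERIV_pos_imp_increasing_open[OF \<open>a < b\<close>])
    fix t assume t: "a < t" "t < b"
    have "\<omega> * (t - a) < \<omega> * (b - a)"
      using t \<open>0 < \<omega>\<close> by simp
    then have "0 < sin (\<omega> * (t - a))"
      using t le \<open>0 < \<omega>\<close> by (intro sin_gt_zero) (simp, linarith)
    then show "\<exists>y. (W has_real_derivative y) (at t) \<and> 0 < y"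
      using W[of t] ineq[of t] t by (intro exI[of _ "(x'' t + \<omega>\<^sup>2 * x t) * sin (\<omega> * (t - a))"]) auto
  next
    show "continuous_on {a..b} W"
      using W by (meson DERIV_isCont continuous_at_imp_continuous_on)
  qed
  moreover have "W a = 0"
    by (simp add: W_def \<open>x a = 0\<close>)
  \<comment> \<open>A positive slope at \<open>b\<close> would make \<open>x\<close> negative just
    to the left of its zero \<open>b\<close>.\<close>
  moreover have "x' b \<le> 0"
  proof (rule ccontr)
    assume "\<not> x' b \<le> 0"
    then obtain d where d: "d > 0" "\<And>h. 0 < h \<Longrightarrow> h < d \<Longrightarrow> x (b - h) < x b"
      using DERIV_pos_inc_left[OF x[of b]] \<open>a < b\<close> by auto
    define h where "h = min d (b - a) / 2"
    have "0 < h" "h < d" "h < b - a"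
      using d(1) \<open>a < b\<close> by (auto simp: h_def)
    then show False
      using d(2)[of h] pos[of "b - h"] \<open>x b = 0\<close> by simp
  qed
  moreover have "0 \<le> sin (\<omega> * (b - a))"
    using le \<open>a < b\<close> \<open>0 < \<omega>\<close> by (intro sin_ge_zero) auto
  ultimately show False
    using mult_nonpos_nonneg[of "x' b" "sin (\<omega> * (b - a))"] by (simp add: W_def \<open>x a = 0\<close> \<open>x b = 0\<close>)
qed

locale ivp_solution =
  fixes s v :: "real \<Rightarrow> real"
  assumes s_deriv: "0 \<le> t \<Longrightarrow> (s has_real_derivative v t) (at t within {0..})"
    and v_deriv: "0 \<le> t \<Longrightarrow> (v has_real_derivative 6 * t - 6 * (s t)\<^sup>2) (at t within {0..})"
    and s_0: "s 0 = 0" and v_0: "v 0 = 0"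
begin

lemma at_within_pos: "at t within {0..} = at t" if "0 < t" for t :: real
  using that by (intro at_within_interior) simp

lemma s_deriv_at: "0 < t \<Longrightarrow> (s has_real_derivative v t) (at t)"
  using s_deriv[of t] at_within_pos[of t] by simp

lemma v_deriv_at: "0 < t \<Longrightarrow> (v has_real_derivative 6 * t - 6 * (s t)\<^sup>2) (at t)"
  using v_deriv[of t] at_within_pos[of t] by simp

lemma continuous_on_s: "continuous_on {0..} s"
  using s_deriv by (intro DERIV_continuous_on) auto

lemma continuous_on_v: "continuous_on {0..} v"
  using v_deriv by (intro DERIV_continuous_on) auto

definition energy :: "real \<Rightarrow> real" where
  "energy t = (v t)\<^sup>2 / 2 + 2 * (s t)^3 - 6 * t * s t"

lemma energy_deriv: "(energy has_real_derivative - 6 * s t) (at t)" if "0 < t"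
  unfolding energy_def
  by (auto intro!: derivative_eq_intros s_deriv_at[OF that] v_deriv_at[OF that]
      simp: field_simps power2_eq_square)

text \<open>Positivity of \<open>s\<close> is assumed only strictly before \<open>T\<close>, so that
  \<open>T\<close> may be the first positive zero of \<open>s\<close>.\<close>

lemma energy_neg:
  assumes "0 < T" and "\<And>t. 0 < t \<Longrightarrow> t < T \<Longrightarrow> 0 < s t"
  shows "energy T < 0"
proof -
  have "energy T < energy 0"
  proof (rule DERIV_neg_imp_decreasing_open[OF \<open>0 < T\<close>])
    show "\<exists>y. (energy has_real_derivative y) (at t) \<and> y < 0" if "0 < t" "t < T" for t
      using energy_deriv[OF that(1)] assms(2)[OF that] by (intro exI[of _ "- 6 * s t"]) auto
    have "continuous_on {0..T} s" "continuous_on {0..T} v"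
      using continuous_on_s continuous_on_v by (auto elim: continuous_on_subset)
    then show "continuous_on {0..T} energy"
      unfolding energy_def by (intro continuous_intros) auto
  qed
  then show ?thesis
    by (simp add: energy_def s_0 v_0)
qed

text \<open>Both \<open>v\<close> and its derivative vanish at \<open>0\<close>, so the sign is
  found by bootstrapping: \<open>v 0 = 0\<close> gives \<open>\<bar>s t\<bar> < t\<close> near
  \<open>0\<close>, which makes \<open>6 * t - 6 * (s t)\<^sup>2\<close> positive, then
  \<open>v\<close>, then \<open>s\<close>.\<close>

lemma s_pos_near_0: "\<exists>d>0. \<forall>t. 0 < t \<and> t < d \<longrightarrow> 0 < s t"
proof -
  have "((\<lambda>t. (s t - s 0) / (t - 0)) \<longlongrightarrow> 0) (at 0 within {0..})"
    using s_deriv[of 0] v_0 by (simp add: has_field_derivative_iff)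
  then have "\<forall>\<^sub>F t in at 0 within {0..}. dist ((s t - s 0) / (t - 0)) 0 < 1"
    by (rule tendstoD) simp
  then obtain e where e: "e > 0" "\<And>t. 0 < t \<Longrightarrow> t < e \<Longrightarrow> \<bar>s t\<bar> < t"
    by (auto simp: eventually_at s_0 dist_real_def field_simps)
  \<comment> \<open>The bound \<open>1\<close> ensures \<open>t\<^sup>2 < t\<close>.\<close>
  define d where "d = min e 1"
  have "0 < d"
    using e(1) by (simp add: d_def)
  have sq: "(s t)\<^sup>2 < t" if "0 < t" "t < d" for t
  proof -
    have "(s t)\<^sup>2 < t\<^sup>2"
      using e(2)[of t] that by (intro power2_strict_mono) (auto simp: d_def)
    also have "t\<^sup>2 < t"
      using that by (simp add: d_def power2_eq_square)
    finally show ?thesis .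
  qed
  have v_pos: "0 < v t" if t: "0 < t" "t < d" for t
  proof -
    have "v 0 < v t"
    proof (rule DERIV_pos_imp_increasing_open[OF t(1)])
      show "\<exists>y. (v has_real_derivative y) (at u) \<and> 0 < y" if "0 < u" "u < t" for u
        using v_deriv_at[OF that(1)] sq[of u] that t by (intro exI[of _ "6 * u - 6 * (s u)\<^sup>2"]) auto
      show "continuous_on {0..t} v"
        using continuous_on_v by (auto elim: continuous_on_subset)
    qed
    then show ?thesis
      by (simp add: v_0)
  qed
  have "0 < s t" if t: "0 < t" "t < d" for t
  proof -
    have "s 0 < s t"
    proof (rule DERIV_pos_imp_increasing_open[OF t(1)])
      show "\<exists>y. (s has_real_derivative y) (at u) \<and> 0 < y" if "0 < u" "u < t" for u
        using s_deriv_at[OF that(1)] v_pos[of u] that t by auto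
      show "continuous_on {0..t} s"
        using continuous_on_s by (auto elim: continuous_on_subset)
    qed
    then show ?thesis
      by (simp add: s_0)
  qed
  with \<open>0 < d\<close> show ?thesis
    by blast
qed

lemma s_pos: "0 < s t" if "0 < t"
proof (rule ccontr)
  assume "\<not> 0 < s t"
  obtain d where d: "d > 0" "\<And>u. 0 < u \<Longrightarrow> u < d \<Longrightarrow> 0 < s u"
    using s_pos_near_0 by blast
  have cont: "continuous_on {d/2..t} s"
    using continuous_on_s d(1) by (auto elim: continuous_on_subset)
  have "d \<le> t"
    using d(2)[of t] \<open>0 < t\<close> \<open>\<not> 0 < s t\<close> by force
  \<comment> \<open>Starting at \<open>d/2\<close> excludes the zero at \<open>0\<close>; the least
    element of the compact set \<open>Z\<close> is then the first positive zero.\<close>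
  define Z where "Z = {u \<in> {d/2..t}. s u = 0}"
  have "closed Z"
    unfolding Z_def using cont by (intro continuous_closed_preimage_constant) auto
  then have "compact Z"
    by (auto simp: compact_eq_bounded_closed Z_def intro: bounded_subset[of "{d/2..t}"])
  moreover have "Z \<noteq> {}"
    using IVT2'[of s t 0 "d/2"] cont d \<open>d \<le> t\<close> \<open>\<not> 0 < s t\<close>
    by (fastforce simp: Z_def less_imp_le not_less)
  ultimately obtain T where T: "T \<in> Z" "\<And>u. u \<in> Z \<Longrightarrow> T \<le> u"
    using compact_attains_inf by metis
  have "0 < s u" if u: "0 < u" "u < T" for u
  proof (rule ccontr)
    assume neg: "\<not> 0 < s u"
    then have "d \<le> u"
      using d(2)[of u] u by force
    have "continuous_on {d/2..u} s"
      using cont T(1) u by (auto simp: Z_def elim: continuous_on_subset)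
    then obtain w where "d/2 \<le> w" "w \<le> u" "s w = 0"
      using IVT2'[of s u 0 "d/2"] d \<open>d \<le> u\<close> neg by (auto simp: less_imp_le not_less)
    then show False
      using T u by (force simp: Z_def)
  qed
  then have "energy T < 0"
    using T(1) d(1) by (intro energy_neg) (auto simp: Z_def)
  \<comment> \<open>At a zero of \<open>s\<close> the energy reduces to
    \<open>(v T)\<^sup>2 / 2\<close>, which is nonnegative.\<close>
  then show False
    using T(1) by (simp add: energy_def Z_def)
qed

text \<open>Dropping the kinetic term from \<open>energy t < 0\<close> leaves
  \<open>2 * s t * ((s t)\<^sup>2 - 3 * t) < 0\<close>, and \<open>s t\<close> is positive.\<close>

lemma s_less: "s t < sqrt 3 * sqrt t" if "0 < t"
proof -
  have "energy t < 0"
    using that s_pos by (intro energy_neg) auto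
  then have "2 * (s t)^3 - 6 * t * s t < 0"
    unfolding energy_def using zero_le_power2[of "v t"] by linarith
  then have "2 * s t * ((s t)\<^sup>2 - 3 * t) < 0"
    by (simp add: algebra_simps power2_eq_square power3_eq_cube)
  then have "(s t)\<^sup>2 < 3 * t"
    using s_pos[OF that] by (simp add: mult_less_0_iff)
  then show ?thesis
    using real_less_rsqrt[of "s t" "3 * t"] by (simp add: real_sqrt_mult)
qed

end

theorem theorem9:
  fixes s :: "real \<Rightarrow> real" and a b :: real
  assumes "solves_ivp s"
    and "0 < a" and "a < b"
    and "\<And>t. t \<in> {a<..<b} \<Longrightarrow> s t > sqrt t"
    and "s a = sqrt a" and "s b = sqrt b"
  shows "b - a > pi * (6 * (1 + sqrt 3)) powr (- 1 / 2) * b powr (- 1 / 4)"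
proof -
  obtain v where "ivp_solution s v"
    using assms(1) by (auto simp: solves_ivp_def ivp_solution_def)
  then interpret ivp_solution s v .
  define \<omega> where "\<omega> = (6 * (1 + sqrt 3)) powr (1 / 2) * b powr (1 / 4)"
  have K: "0 < 6 * (1 + sqrt 3)"
    by (simp add: add_pos_pos)
  have "0 < \<omega>"
    using K \<open>0 < a\<close> \<open>a < b\<close> by (simp add: \<omega>_def)
  have \<omega>2: "\<omega>\<^sup>2 = 6 * (1 + sqrt 3) * sqrt b"
  proof -
    have "((6 * (1 + sqrt 3)) powr (1 / 2))\<^sup>2 = 6 * (1 + sqrt 3)"
      using K by (simp add: powr_half_sqrt)
    moreover have "(b powr (1 / 4))\<^sup>2 = sqrt b"
      using \<open>0 < a\<close> \<open>a < b\<close> by (simp add: powr_power powr_half_sqrt)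
    ultimately show ?thesis
      by (simp add: \<omega>_def power_mult_distrib)
  qed
  have "pi / \<omega> < b - a"
  proof (rule sturm_comparison_sin[where x = "\<lambda>t. s t - sqrt t"
        and x' = "\<lambda>t. v t - inverse (sqrt t) / 2"
        and x'' = "\<lambda>t. 6 * t - 6 * (s t)\<^sup>2 + inverse (sqrt t) ^ 3 / 4"])
    fix t assume "t \<in> {a..b}"
    then have "0 < t"
      using \<open>0 < a\<close> by simp
    show "((\<lambda>t. s t - sqrt t) has_real_derivative v t - inverse (sqrt t) / 2) (at t)"
      using \<open>0 < t\<close> by (auto intro!: derivative_eq_intros s_deriv_at simp: field_simps)
    show "((\<lambda>t. v t - inverse (sqrt t) / 2) has_real_derivative
        6 * t - 6 * (s t)\<^sup>2 + inverse (sqrt t) ^ 3 / 4) (at t)"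
      using \<open>0 < t\<close>
      by (auto intro!: derivative_eq_intros v_deriv_at simp: field_simps power3_eq_cube)
  next
    fix t assume t: "t \<in> {a<..<b}"
    then have "0 < t"
      using \<open>0 < a\<close> by simp
    have "6 * (s t + sqrt t) \<le> 6 * (1 + sqrt 3) * sqrt t"
      using s_less[OF \<open>0 < t\<close>] by (simp add: algebra_simps)
    also have "\<dots> \<le> \<omega>\<^sup>2"
      unfolding \<omega>2 using t by (intro mult_left_mono) (auto simp: add_nonneg_nonneg)
    finally have "6 * (s t + sqrt t) * (s t - sqrt t) \<le> \<omega>\<^sup>2 * (s t - sqrt t)"
      using assms(4)[OF t] by (intro mult_right_mono) auto
    moreover have "6 * (s t + sqrt t) * (s t - sqrt t) = 6 * (s t)\<^sup>2 - 6 * t"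
      using \<open>0 < t\<close> by (simp add: algebra_simps power2_eq_square)
    \<comment> \<open>This term, from the second derivative of \<open>- sqrt t\<close>, makes the
      differential inequality strict.\<close>
    moreover have "0 < inverse (sqrt t) ^ 3"
      using \<open>0 < t\<close> by simp
    ultimately show "0 < 6 * t - 6 * (s t)\<^sup>2 + inverse (sqrt t) ^ 3 / 4 + \<omega>\<^sup>2 * (s t - sqrt t)"
      by linarith
  qed (use assms \<open>0 < \<omega>\<close> in auto)
  moreover have "pi / \<omega> = pi * (6 * (1 + sqrt 3)) powr (- 1 / 2) * b powr (- 1 / 4)"
    by (simp add: \<omega>_def powr_minus field_simps)
  ultimately show ?thesis
    by simp
qed

end
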